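(* Fix $p\in(1,2]$. Let $(u_i)_{i\in\mathbb N}$ be a random family of non-negative numbers with $\mathbb E\left(\sum_{i\in\mathbb N}u_i\right)=1$, and let $(G_n(1))_{n\in\mathbb N}$ be the associated Mandelbrot cascade total mass process (see context), with almost sure limit $G_\infty(1)$. If $$\mathbb E\left[\left(\sum_{i\in\mathbb N}u_i\right)^p\right]<+\infty\quad\text{and}\quad\mathbb E\left[\sum_{i\in\mathbb N}u_i^p\right]<1,$$ then there exists a constant $C>0$ such that, for all $n\ge0$, $$\sqrt[p]{\mathbb E\left(|G_n(1)-G_\infty(1)|^p\right)}\le C\left[\mathbb E\left(\sum_{i\in\mathbb N}u_i^p\right)\right]^{n/p}.$$
   Context: $\mathbb N=\{0,1,2,\dots\}$. For $n\ge0$ and $e\in\mathbb N^n$ (with $\mathbb N^0=\{\emptyset\}$), let $(u_{ei})_{i\in\mathbb N}$ be independent (over all finite words $e$) copies of the random family $(u_i)_{i\in\mathbb N}$, where $ei$ denotes concatenation. Set $w_\emptyset=1$, $w_{ei}=w_eu_{ei}$ and $G_n(1)=\sum_{e\in\mathbb N^n}w_e$ (so $G_0(1)=1$). This is the weighted branching process with a single type and initial configuration a single particle of weight 1. Since $\mathbb E(\sum_iu_i)=1$, $(G_n(1))_n$ is a non-negative martingale and converges almost surely to a random variable denoted $G_\infty(1)$. *)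

theory Defs
  imports "HOL-Probability.Probability"
begin

text \<open>
  Real powers of extended non-negative reals, for exponents \<open>a \<ge> 0\<close>, with \<open>x\<^sup>0 = 1\<close>
  for every \<open>x\<close> (unlike \<^const>\<open>powr\<close>, which has \<open>0 powr 0 = 0\<close>) and \<open>\<infinity>\<^sup>a = \<infinity>\<close> for \<open>a > 0\<close>.
\<close>

definition ennpow :: "ennreal \<Rightarrow> real \<Rightarrow> ennreal" where
  "ennpow x a =
    (if a = 0 then 1 else if x = \<infinity> then \<infinity> else ennreal (enn2real x powr a))"

definition nonneg_random_family :: "'b measure \<Rightarrow> (nat \<Rightarrow> 'b \<Rightarrow> real) \<Rightarrow> bool" where
  "nonneg_random_family N u \<longleftrightarrow>
    prob_space N \<and> (\<forall>i. u i \<in> borel_measurable N) \<and> (\<forall>i. \<forall>\<omega>\<in>space N. 0 \<le> u i \<omega>)"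

text \<open>
  A finite word over \<open>\<nat>\<close> is encoded as a list whose head is its last letter, so that the
  concatenation \<open>e i\<close> is \<open>i # e\<close>.  The variable \<open>u\<^bsub>e i\<^esub>\<close> is \<open>U e i\<close>.
  The members of one family \<open>(U e i)\<^sub>i\<close> may depend on each other; independence is between
  the whole sequences belonging to different words \<open>e\<close>.
\<close>

definition independent_copies ::
    "'b measure \<Rightarrow> (nat \<Rightarrow> 'b \<Rightarrow> real) \<Rightarrow> 'a measure \<Rightarrow> (nat list \<Rightarrow> nat \<Rightarrow> 'a \<Rightarrow> real) \<Rightarrow> bool" where
  "independent_copies N u M U \<longleftrightarrow>
    prob_space M \<and>
    prob_space.indep_vars M (\<lambda>_. Pi\<^sub>M UNIV (\<lambda>_. borel)) (\<lambda>e \<omega> i. U e i \<omega>) UNIV \<and>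
    (\<forall>e. distr M (Pi\<^sub>M UNIV (\<lambda>_. borel)) (\<lambda>\<omega> i. U e i \<omega>) =
         distr N (Pi\<^sub>M UNIV (\<lambda>_. borel)) (\<lambda>\<omega> i. u i \<omega>))"

primrec weight :: "(nat list \<Rightarrow> nat \<Rightarrow> 'a \<Rightarrow> real) \<Rightarrow> nat list \<Rightarrow> 'a \<Rightarrow> real" where
  "weight U [] \<omega> = 1"
| "weight U (i # e) \<omega> = weight U e \<omega> * U e i \<omega>"

text \<open>
  The value is \<open>0\<close> where the series of weights diverges; for independent copies of a family
  with mean sum \<open>1\<close> the series has mean \<open>1\<close>, so this is a null event.
\<close>

definition total_mass :: "(nat list \<Rightarrow> nat \<Rightarrow> 'a \<Rightarrow> real) \<Rightarrow> nat \<Rightarrow> 'a \<Rightarrow> real" where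
  "total_mass U n \<omega> = (\<Sum>\<^sub>\<infinity>e\<in>{e. length e = n}. weight U e \<omega>)"

text \<open>
  In that setting the limit exists almost surely (non-negative martingale); the value on the
  exceptional null event is immaterial.
\<close>

definition limit_mass :: "(nat list \<Rightarrow> nat \<Rightarrow> 'a \<Rightarrow> real) \<Rightarrow> 'a \<Rightarrow> real" where
  "limit_mass U \<omega> = lim (\<lambda>n. total_mass U n \<omega>)"

end

theory Submission
  imports Defs
begin

text \<open>
  Let \<open>w\<^sub>e\<close> be the weight of a word \<open>e\<close>, let \<open>S\<^sub>e\<close> be the sum of the family attached to it, and let
  \<open>m = E(\<Sum>\<^sub>i u\<^sub>i\<^sup>p)\<close>. The weights of the children of \<open>e\<close> add up to \<open>w\<^sub>e S\<^sub>e\<close>, so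
  \<open>G\<^sub>k - G\<^sub>n = \<Sum> w\<^sub>e (S\<^sub>e - 1)\<close>, the sum over all words with \<open>n \<le> |e| < k\<close>
  (\<open>has_sum_increments\<close>). Every factor \<open>S\<^sub>e - 1\<close> is centred and independent of \<open>w\<^sub>e\<close> and of all
  terms that belong to other words no longer than \<open>e\<close>. The sum is therefore a martingale transform,
  not only level by level but word by word.

  For \<open>1 < p \<le> 2\<close>, a centred \<open>X\<close> that is independent of \<open>(D, W)\<close> satisfies
  \<open>E|D + W X|\<^sup>p \<le> E|D|\<^sup>p + 3 E|W|\<^sup>p E|X|\<^sup>p\<close> (\<open>martingale_step\<close>): in the pointwise expansion
  \<open>abs_add_powr_le\<close> the term linear in \<open>X\<close> has mean zero. Adding words in order of length
  bounds the \<open>p\<close>-th moment of any finite subsum by \<open>3 E|S - 1|\<^sup>p \<Sum> E w\<^sub>e\<^sup>p\<close>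
  (\<open>increment_moment\<close>). Since \<open>w\<^sub>e\<close> is a product of independent factors, the moments \<open>E w\<^sub>e\<^sup>p\<close> over
  the words of length \<open>j\<close> add up to at most \<open>m\<^sup>j\<close> (\<open>sum_weight_moments_le\<close>). Summing this geometric
  series over \<open>j \<ge> n\<close> gives the bound \<open>K m\<^sup>n\<close> with \<open>K = 3 E|S - 1|\<^sup>p / (1 - m)\<close>, which depends neither
  on \<open>k\<close> nor on the finite set of words.

  Fatou's lemma passes first to the infinite sum \<open>G\<^sub>k - G\<^sub>n\<close>, then, as \<open>k\<close> tends to infinity, to
  \<open>G\<^sub>\<infinity> - G\<^sub>n\<close>. The almost sure convergence needed for the last step comes from the same bound:
  it makes \<open>E|G\<^sub>k\<^sub>+\<^sub>1 - G\<^sub>k|\<close> summable in \<open>k\<close> (\<open>AE_summable_mass_steps\<close>). Taking \<open>p\<close>-th roots concludes.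
\<close>

section \<open>An inequality for sums with an independent centred term\<close>

text \<open>Subadditivity of the concave function \<open>t \<mapsto> t\<^sup>q\<close>.\<close>
lemma abs_powr_diff_le:
  fixes a x q :: real
  assumes "x > 0" "a > 0" "0 < q" "q \<le> 1"
  shows "\<bar>x powr q - a powr q\<bar> \<le> \<bar>x - a\<bar> powr q"
proof -
  have sub: "(u + v) powr q \<le> u powr q + v powr q" if "u > 0" "v > 0" for u v :: real
  proof -
    have t: "t \<le> t powr q" if "0 < t" "t \<le> 1" for t :: real
      using powr_mono'[of q 1 t] that assms by simp
    have "1 \<le> (u / (u+v)) powr q + (v/(u+v)) powr q"
    proof -
      have "u / (u + v) + v / (u + v) = 1" using that by (simp flip: add_divide_distrib)
      moreover have "u / (u + v) \<le> (u / (u + v)) powr q" "v / (u + v) \<le> (v / (u + v)) powr q"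
        using that by (auto intro!: t)
      ultimately show ?thesis by linarith
    qed
    also have "... = (u powr q + v powr q) / (u+v) powr q"
      using that by (simp add: powr_divide add_divide_distrib)
    finally show ?thesis using that by (simp add: field_simps)
  qed
  consider "x = a" | "x < a" | "x > a" by linarith
  then show ?thesis
  proof cases
    case 2
    then have "x powr q \<le> a powr q" using assms by (intro powr_mono2) auto
    then show ?thesis using sub[of x "a - x"] assms 2 by auto
  next
    case 3
    then have "a powr q \<le> x powr q" using assms by (intro powr_mono2) auto
    then show ?thesis using sub[of a "x - a"] assms 3 by auto
  qed auto
qed

text \<open>
  A first-order expansion of \<open>|\<cdot>|\<^sup>p\<close> at \<open>a\<close> whose remainder is uniform in \<open>a\<close>, because the derivative
  of \<open>|\<cdot>|\<^sup>p\<close> is Hoelder continuous of order \<open>p - 1\<close>. If \<open>a\<close> and \<open>x = a + b\<close> have the same sign, convexity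
  bounds \<open>|x|\<^sup>p\<close> through the tangent at \<open>x\<close>, and subadditivity of \<open>t\<^sup>p\<^sup>-\<^sup>1\<close> moves the slope from \<open>x\<close> to
  \<open>a\<close>, at cost \<open>p |b|\<^sup>p\<close>. Otherwise \<open>|a| \<le> |b|\<close> and each term is of order \<open>|b|\<^sup>p\<close>.
\<close>
lemma abs_add_powr_le:
  fixes a b p :: real
  assumes p: "1 < p" "p \<le> 2"
  shows "\<bar>a + b\<bar> powr p \<le> \<bar>a\<bar> powr p + p * (sgn a * \<bar>a\<bar> powr (p - 1) * b) + 3 * \<bar>b\<bar> powr p"
proof -
  have powr_split: "x powr p = x powr (p - 1) * x" if "x \<ge> 0" for x :: real
    using that p by (cases "x = 0") (auto simp: powr_mult_base powr_diff)
  have *: "\<bar>a + b\<bar> powr p \<le> a powr p + p * (a powr (p - 1) * b) + 3 * \<bar>b\<bar> powr p" if a: "a > 0" for a b :: real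
  proof (cases "a + b > 0")
    case True
    define x where "x = a + b"
    have x: "x > 0" using True by (simp add: x_def)
    \<comment> \<open>The tangent of \<open>t\<^sup>p\<close> at \<open>x\<close> lies below the graph at \<open>a\<close>; for powers this is Young's inequality.\<close>
    have young: "p * (x powr (p - 1) * a) \<le> (p - 1) * x powr p + a powr p"
    proof -
      have "x powr (p - 1) * a = (x powr p) powr ((p - 1) / p) * (a powr p) powr (1 / p)"
        using a x p by (simp add: powr_powr)
      also have "\<dots> \<le> (p - 1) / p * x powr p + 1 / p * a powr p"
        by (rule Youngs_inequality_0) (use a x p in \<open>auto simp: field_simps\<close>)
      finally show ?thesis using p by (simp add: field_simps)
    qed
    have subadd: "(x powr (p - 1) - a powr (p - 1)) * b \<le> \<bar>b\<bar> powr p"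
    proof -
      have "\<bar>x powr (p - 1) - a powr (p - 1)\<bar> \<le> \<bar>b\<bar> powr (p - 1)"
        using abs_powr_diff_le[of x a "p - 1"] x a p by (simp add: x_def)
      then have "\<bar>x powr (p - 1) - a powr (p - 1)\<bar> * \<bar>b\<bar> \<le> \<bar>b\<bar> powr (p - 1) * \<bar>b\<bar>"
        by (rule mult_right_mono) simp
      then show ?thesis
        unfolding powr_split[OF abs_ge_zero, of b] by (simp flip: abs_mult)
    qed
    have "x powr p = p * x powr p - (p - 1) * x powr p" by (simp add: algebra_simps)
    also have "p * x powr p = p * (x powr (p - 1) * a) + p * (x powr (p - 1) * b)"
      unfolding powr_split[OF less_imp_le[OF x]] by (simp add: x_def algebra_simps)
    also have "\<dots> - (p - 1) * x powr p \<le> a powr p + p * (x powr (p - 1) * b)"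
      using young by simp
    also have "p * (x powr (p - 1) * b) = p * (a powr (p - 1) * b) + p * ((x powr (p - 1) - a powr (p - 1)) * b)"
      by (simp add: algebra_simps)
    also have "p * ((x powr (p - 1) - a powr (p - 1)) * b) \<le> 3 * \<bar>b\<bar> powr p"
      using subadd p by (intro order_trans[OF mult_left_mono[OF subadd]] mult_right_mono) auto
    finally show ?thesis using x by (simp add: x_def)
  next
    case False
    then have b: "b \<le> - a" by simp
    have "\<bar>a + b\<bar> powr p \<le> \<bar>b\<bar> powr p" using a b p by (intro powr_mono2) auto
    moreover have "p * (a powr (p - 1) * \<bar>b\<bar>) \<le> 2 * (\<bar>b\<bar> powr (p - 1) * \<bar>b\<bar>)"
      using a b p by (intro mult_mono powr_mono2 mult_nonneg_nonneg powr_ge_zero abs_ge_zero) auto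
    moreover have "p * (a powr (p - 1) * b) = - (p * (a powr (p - 1) * \<bar>b\<bar>))"
    proof -
      have "\<bar>b\<bar> = - b" using a b by simp
      then show ?thesis by (simp only: mult_minus_right minus_minus)
    qed
    moreover have "a powr p \<ge> 0" by simp
    ultimately show ?thesis unfolding powr_split[OF abs_ge_zero, of b] by linarith
  qed
  consider "a > 0" | "a = 0" | "a < 0" by linarith
  then show ?thesis
  proof cases
    case 3
    moreover have "\<bar>- a + - b\<bar> = \<bar>a + b\<bar>" by linarith
    ultimately show ?thesis using *[of "- a" "- b"] by simp
  qed (use *[of a b] p in auto)
qed

text \<open>
  The form of Fatou's lemma in which bounds are passed to limits. The limit \<open>Y\<close> may be any
  version of an almost sure limit, such as a difference of total masses, whose value at exceptional points
  is arbitrary.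
\<close>
lemma nn_integral_powr_limit_le:
  fixes X :: "nat \<Rightarrow> 'a \<Rightarrow> real"
  assumes [measurable]: "\<And>j. X j \<in> borel_measurable M"
    and lim: "AE \<omega> in M. (\<lambda>j. X j \<omega>) \<longlonglongrightarrow> Y \<omega>"
    and bound: "\<And>j. (\<integral>\<^sup>+\<omega>. ennreal (\<bar>X j \<omega>\<bar> powr p) \<partial>M) \<le> B"
    and p: "p > 0"
  shows "(\<integral>\<^sup>+\<omega>. ennreal (\<bar>Y \<omega>\<bar> powr p) \<partial>M) \<le> B"
proof -
  have "(\<integral>\<^sup>+\<omega>. ennreal (\<bar>Y \<omega>\<bar> powr p) \<partial>M) = (\<integral>\<^sup>+\<omega>. liminf (\<lambda>j. ennreal (\<bar>X j \<omega>\<bar> powr p)) \<partial>M)"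
  proof (rule nn_integral_cong_AE, use lim in eventually_elim)
    fix \<omega> assume "(\<lambda>j. X j \<omega>) \<longlonglongrightarrow> Y \<omega>"
    then have "(\<lambda>j. ennreal (\<bar>X j \<omega>\<bar> powr p)) \<longlonglongrightarrow> ennreal (\<bar>Y \<omega>\<bar> powr p)"
      using p by (intro tendsto_ennrealI tendsto_powr' tendsto_intros) auto
    then show "ennreal (\<bar>Y \<omega>\<bar> powr p) = liminf (\<lambda>j. ennreal (\<bar>X j \<omega>\<bar> powr p))"
      by (intro lim_imp_Liminf[symmetric]) auto
  qed
  also have "\<dots> \<le> liminf (\<lambda>j. \<integral>\<^sup>+\<omega>. ennreal (\<bar>X j \<omega>\<bar> powr p) \<partial>M)"
    by (rule nn_integral_liminf) measurable
  also have "\<dots> \<le> liminf (\<lambda>j::nat. B)"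
    by (intro Liminf_mono) (simp add: bound)
  finally show ?thesis by (simp add: Liminf_const)
qed

text \<open>
  One step of the von Bahr--Esseen inequality. The independence hypotheses are stated for exactly the
  two products that occur after expanding at \<open>D\<close>: the linear term, which vanishes in
  the mean, and the remainder, whose expectation factorises.
\<close>
lemma (in prob_space) martingale_step:
  fixes D W X :: "'a \<Rightarrow> real"
  assumes p: "1 < p" "p \<le> 2"
    and [measurable]: "D \<in> borel_measurable M" "W \<in> borel_measurable M" "X \<in> borel_measurable M"
    and indP: "indep_var borel (\<lambda>\<omega>. sgn (D \<omega>) * \<bar>D \<omega>\<bar> powr (p - 1) * W \<omega>) borel X"
    and indW: "indep_var borel (\<lambda>\<omega>. \<bar>W \<omega>\<bar> powr p) borel (\<lambda>\<omega>. \<bar>X \<omega>\<bar> powr p)"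
    and D: "integrable M (\<lambda>\<omega>. \<bar>D \<omega>\<bar> powr p)"
    and W: "integrable M (\<lambda>\<omega>. \<bar>W \<omega>\<bar> powr p)"
    and X: "integrable M (\<lambda>\<omega>. \<bar>X \<omega>\<bar> powr p)"
    and centred: "expectation X = 0"
  shows "integrable M (\<lambda>\<omega>. \<bar>D \<omega> + W \<omega> * X \<omega>\<bar> powr p)" (is ?int)
    and "expectation (\<lambda>\<omega>. \<bar>D \<omega> + W \<omega> * X \<omega>\<bar> powr p)
      \<le> expectation (\<lambda>\<omega>. \<bar>D \<omega>\<bar> powr p) + 3 * (expectation (\<lambda>\<omega>. \<bar>W \<omega>\<bar> powr p) * expectation (\<lambda>\<omega>. \<bar>X \<omega>\<bar> powr p))" (is ?le)
proof -
  define \<psi> where "\<psi> a = sgn a * \<bar>a\<bar> powr (p - 1)" for a :: real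
  have [measurable]: "\<psi> \<in> borel_measurable borel" unfolding \<psi>_def by measurable
  have intX: "integrable M X"
  proof (rule Bochner_Integration.integrable_bound)
    show "integrable M (\<lambda>\<omega>. 1 + \<bar>X \<omega>\<bar> powr p)" using X by simp
    have "\<bar>x\<bar> \<le> 1 + \<bar>x\<bar> powr p" for x :: real
      using powr_mono[of 1 p "\<bar>x\<bar>"] p by (cases "\<bar>x\<bar> \<le> 1") (auto intro: add_increasing2)
    then show "AE \<omega> in M. norm (X \<omega>) \<le> norm (1 + \<bar>X \<omega>\<bar> powr p)" by simp
  qed simp
  have intP: "integrable M (\<lambda>\<omega>. \<psi> (D \<omega>) * W \<omega>)"
  proof (rule Bochner_Integration.integrable_bound)
    show "integrable M (\<lambda>\<omega>. \<bar>D \<omega>\<bar> powr p + \<bar>W \<omega>\<bar> powr p)" using D W by simp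
    have "\<bar>\<psi> d * w\<bar> \<le> \<bar>d\<bar> powr p + \<bar>w\<bar> powr p" for d w :: real
    proof -
      define z where "z = max \<bar>d\<bar> \<bar>w\<bar>"
      have z: "z \<ge> 0" by (simp add: z_def)
      have "\<bar>\<psi> d * w\<bar> \<le> \<bar>d\<bar> powr (p - 1) * \<bar>w\<bar>"
        by (simp add: \<psi>_def abs_mult abs_sgn_eq)
      also have "\<dots> \<le> z powr (p - 1) * z" using p z by (intro mult_mono powr_mono2) (auto simp: z_def)
      also have "\<dots> = z powr p" using z p by (cases "z = 0") (auto simp: powr_diff)
      also have "\<dots> \<le> \<bar>d\<bar> powr p + \<bar>w\<bar> powr p" by (simp add: z_def max_def)
      finally show ?thesis .
    qed
    then show "AE \<omega> in M. norm (\<psi> (D \<omega>) * W \<omega>) \<le> norm (\<bar>D \<omega>\<bar> powr p + \<bar>W \<omega>\<bar> powr p)" by simp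
  qed measurable
  note indP = indP[folded \<psi>_def]
  note i1 = indep_var_integrable[OF indP intP intX] and i2 = indep_var_integrable[OF indW W X]
  let ?R = "\<lambda>\<omega>. \<bar>D \<omega>\<bar> powr p + p * (\<psi> (D \<omega>) * W \<omega> * X \<omega>) + 3 * (\<bar>W \<omega>\<bar> powr p * \<bar>X \<omega>\<bar> powr p)"
  have R: "integrable M ?R" using D i1 i2 by simp
  have le: "\<bar>D \<omega> + W \<omega> * X \<omega>\<bar> powr p \<le> ?R \<omega>" for \<omega>
    using abs_add_powr_le[OF p, of "D \<omega>" "W \<omega> * X \<omega>"]
    by (simp add: \<psi>_def abs_mult powr_mult mult.assoc)
  show ?int
    by (rule Bochner_Integration.integrable_bound[OF R]) (use le in \<open>auto intro: order_trans[OF _ abs_ge_self]\<close>)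
  then have "expectation (\<lambda>\<omega>. \<bar>D \<omega> + W \<omega> * X \<omega>\<bar> powr p) \<le> expectation ?R"
    using R le by (intro integral_mono)
  also have "\<dots> = expectation (\<lambda>\<omega>. \<bar>D \<omega>\<bar> powr p)
      + p * expectation (\<lambda>\<omega>. \<psi> (D \<omega>) * W \<omega> * X \<omega>) + 3 * expectation (\<lambda>\<omega>. \<bar>W \<omega>\<bar> powr p * \<bar>X \<omega>\<bar> powr p)"
    using D i1 i2 by simp
  finally show ?le
    unfolding indep_var_lebesgue_integral[OF indP intP intX] indep_var_lebesgue_integral[OF indW W X] centred
    by simp
qed

section \<open>Truncated sums over countable index sets\<close>

lemma finite_truncation: "finite {e\<in>A. to_nat e < j}" for A :: "'c::countable set"
  by (rule finite_subset[OF _ finite_vimageI[OF finite_lessThan[of j] inj_to_nat]]) auto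

text \<open>
  Unordered sums are limits along a net, whereas Fatou's lemma and measurability of limits need sequences.
\<close>
lemma has_sum_imp_truncated_sums:
  fixes f :: "'c::countable \<Rightarrow> 'd::{comm_monoid_add, topological_space}"
  assumes "(f has_sum s) A"
  shows "(\<lambda>j. \<Sum>e\<in>{e\<in>A. to_nat e < j}. f e) \<longlonglongrightarrow> s"
proof -
  have "filterlim (\<lambda>j. {e\<in>A. to_nat e < j}) (finite_subsets_at_top A) sequentially"
    unfolding filterlim_finite_subsets_at_top
  proof safe
    fix X assume X: "finite X" "X \<subseteq> A"
    have "\<forall>\<^sub>F j in sequentially. \<forall>e\<in>X. to_nat e < j"
      using X(1) by (intro eventually_ball_finite) (auto intro: eventually_gt_at_top)
    then show "\<forall>\<^sub>F j in sequentially. finite {e\<in>A. to_nat e < j} \<and> X \<subseteq> {e\<in>A. to_nat e < j} \<and> {e\<in>A. to_nat e < j} \<subseteq> A"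
      by eventually_elim (use X finite_truncation in auto)
  qed
  with assms show ?thesis unfolding has_sum_def by (rule filterlim_compose)
qed

section \<open>Weights of words and their moments\<close>

abbreviation seq_borel :: "(nat \<Rightarrow> real) measure" where
  "seq_borel \<equiv> Pi\<^sub>M UNIV (\<lambda>_. borel)"

definition moment :: "(nat \<Rightarrow> real) measure \<Rightarrow> real \<Rightarrow> ennreal" where
  "moment \<mu> a = (\<integral>\<^sup>+x. (\<Sum>i. ennreal (\<bar>x i\<bar> powr a)) \<partial>\<mu>)"

text \<open>
  On a nonnegative sequence whose series diverges the value is \<open>suminf\<close>'s default minus one; under
  the hypotheses made on the law such sequences form a null set.
\<close>
definition excess :: "(nat \<Rightarrow> real) \<Rightarrow> real" where
  "excess x = (\<Sum>i. x i) - 1"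

text \<open>
  The canonical family on the space of all labellings of words. Then \<open>weight letter e\<close> is the weight as a
  function of the labelling, which turns the fact that weights depend only on the labels of proper prefixes
  into a statement about measurable functions on a partial product space.
\<close>
abbreviation letter :: "nat list \<Rightarrow> nat \<Rightarrow> (nat list \<Rightarrow> nat \<Rightarrow> real) \<Rightarrow> real" where
  "letter \<equiv> \<lambda>e i h. h e i"

lemma measurable_excess [measurable]: "excess \<in> borel_measurable seq_borel"
  unfolding excess_def[abs_def] by measurable

lemma weight_letter_restrict:
  assumes "\<And>f. length f < length e \<Longrightarrow> f \<in> B"
  shows "weight letter e (\<lambda>f\<in>B. \<lambda>i. U f i \<omega>) = weight U e \<omega>"
  using assms by (induction e) auto

lemma measurable_weight_letter:
  assumes "\<And>f. length f < length e \<Longrightarrow> f \<in> B"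
  shows "weight letter e \<in> borel_measurable (Pi\<^sub>M B (\<lambda>_. seq_borel))"
  using assms
proof (induction e)
  case (Cons i e)
  from Cons have [measurable]: "weight letter e \<in> borel_measurable (Pi\<^sub>M B (\<lambda>_. seq_borel))" by simp
  from Cons have "e \<in> B" by simp
  then have "(\<lambda>h. h e) \<in> Pi\<^sub>M B (\<lambda>_. seq_borel) \<rightarrow>\<^sub>M seq_borel"
    by (rule measurable_component_singleton)
  then have [measurable]: "letter e i \<in> borel_measurable (Pi\<^sub>M B (\<lambda>_. seq_borel))"
    by (rule measurable_compose) measurable
  show ?case by simp
qed (simp add: weight.simps(1)[abs_def])

locale weighted_branching = prob_space M
  for M :: "'a measure" +
  fixes U :: "nat list \<Rightarrow> nat \<Rightarrow> 'a \<Rightarrow> real" and \<mu> :: "(nat \<Rightarrow> real) measure"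
  assumes indep: "indep_vars (\<lambda>_. seq_borel) (\<lambda>e \<omega> i. U e i \<omega>) UNIV"
    and law: "\<And>e. distr M seq_borel (\<lambda>\<omega> i. U e i \<omega>) = \<mu>"
    and nonneg: "AE x in \<mu>. \<forall>i. 0 \<le> x i"
    and mean: "moment \<mu> 1 = 1"
begin

definition increment :: "nat list set \<Rightarrow> 'a \<Rightarrow> real" where
  "increment F \<omega> = (\<Sum>e\<in>F. weight U e \<omega> * excess (\<lambda>i. U e i \<omega>))"

lemma measurable_family [measurable]: "(\<lambda>\<omega> i. U e i \<omega>) \<in> M \<rightarrow>\<^sub>M seq_borel"
  using indep by (auto simp: indep_vars_def2)

lemma sets_law [measurable_cong]: "sets \<mu> = sets seq_borel"
  by (simp flip: law[of "[]"])

lemma measurable_U [measurable]: "U e i \<in> borel_measurable M"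
  using measurable_compose[OF measurable_family[of e] measurable_component_singleton[of i]] by simp

lemma measurable_weight [measurable]: "weight U e \<in> borel_measurable M"
  by (induction e) simp_all

lemma measurable_increment [measurable]: "increment F \<in> borel_measurable M"
  unfolding increment_def[abs_def] by measurable

lemma nn_integral_family:
  assumes [measurable]: "g \<in> borel_measurable seq_borel"
  shows "(\<integral>\<^sup>+\<omega>. g (\<lambda>i. U e i \<omega>) \<partial>M) = (\<integral>\<^sup>+x. g x \<partial>\<mu>)"
  unfolding law[of e, symmetric] by (subst nn_integral_distr) measurable

lemma AE_family:
  assumes "AE x in \<mu>. P x"
  shows "AE \<omega> in M. P (\<lambda>i. U e i \<omega>)"
  by (rule AE_distrD[OF measurable_family[of e]]) (unfold law, rule assms)

text \<open>
  The family at \<open>e\<close> is independent of anything computed from the families at all other words. All uses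
  of independence go through this lemma.
\<close>
lemma indep_node:
  assumes f: "f \<in> Pi\<^sub>M (- {e}) (\<lambda>_. seq_borel) \<rightarrow>\<^sub>M N1" and g: "g \<in> seq_borel \<rightarrow>\<^sub>M N2"
  shows "indep_var N1 (\<lambda>\<omega>. f (\<lambda>e'\<in>- {e}. \<lambda>i. U e' i \<omega>)) N2 (\<lambda>\<omega>. g (\<lambda>i. U e i \<omega>))"
proof -
  have "indep_var (Pi\<^sub>M (- {e}) (\<lambda>_. seq_borel)) (\<lambda>\<omega>. \<lambda>e'\<in>- {e}. \<lambda>i. U e' i \<omega>)
      (Pi\<^sub>M {e} (\<lambda>_. seq_borel)) (\<lambda>\<omega>. \<lambda>e'\<in>{e}. \<lambda>i. U e' i \<omega>)"
    by (rule indep_var_restrict[OF indep]) auto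
  moreover have "(\<lambda>h. g (h e)) \<in> Pi\<^sub>M {e} (\<lambda>_. seq_borel) \<rightarrow>\<^sub>M N2"
    by (rule measurable_compose[OF _ g]) (rule measurable_component_singleton, simp)
  ultimately have "indep_var N1 (f \<circ> (\<lambda>\<omega>. \<lambda>e'\<in>- {e}. \<lambda>i. U e' i \<omega>))
      N2 ((\<lambda>h. g (h e)) \<circ> (\<lambda>\<omega>. \<lambda>e'\<in>{e}. \<lambda>i. U e' i \<omega>))"
    by (intro indep_var_compose[OF _ f])
  then show ?thesis by (simp add: comp_def)
qed

lemma weight_restrict: "weight letter f (\<lambda>e'\<in>- {e}. \<lambda>i. U e' i \<omega>) = weight U f \<omega>"
  if "length f \<le> length e"
  using that by (intro weight_letter_restrict) auto

lemma nn_integral_weight_Cons: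
  "(\<integral>\<^sup>+\<omega>. ennreal (\<bar>weight U (i # e) \<omega>\<bar> powr a) \<partial>M)
    = (\<integral>\<^sup>+\<omega>. ennreal (\<bar>weight U e \<omega>\<bar> powr a) \<partial>M) * (\<integral>\<^sup>+x. ennreal (\<bar>x i\<bar> powr a) \<partial>\<mu>)"
proof -
  define w where "w = (\<lambda>\<omega>. ennreal (\<bar>weight U e \<omega>\<bar> powr a))"
  define v where "v = (\<lambda>\<omega>. ennreal (\<bar>U e i \<omega>\<bar> powr a))"
  have [measurable]: "weight letter e \<in> borel_measurable (Pi\<^sub>M (- {e}) (\<lambda>_. seq_borel))"
    by (rule measurable_weight_letter) auto
  have "indep_var borel w borel v"
    using indep_node[where e = e and f = "\<lambda>h. ennreal (\<bar>weight letter e h\<bar> powr a)" and ?N1.0 = borel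
        and g = "\<lambda>x. ennreal (\<bar>x i\<bar> powr a)" and ?N2.0 = borel]
    by (simp add: weight_restrict w_def v_def)
  then have ind: "indep_vars (\<lambda>_. borel) (case_bool w v) UNIV"
    unfolding indep_var_def by (rule back_subst[of "\<lambda>f. indep_vars f _ _"]) (auto split: bool.split)
  have "(\<integral>\<^sup>+\<omega>. w \<omega> * v \<omega> \<partial>M) = (\<integral>\<^sup>+\<omega>. w \<omega> \<partial>M) * (\<integral>\<^sup>+\<omega>. v \<omega> \<partial>M)"
    using indep_vars_nn_integral[OF _ ind] by (simp add: UNIV_bool mult.commute)
  also have "(\<integral>\<^sup>+\<omega>. v \<omega> \<partial>M) = (\<integral>\<^sup>+x. ennreal (\<bar>x i\<bar> powr a) \<partial>\<mu>)"
    unfolding v_def by (rule nn_integral_family) measurable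
  finally show ?thesis by (simp add: w_def v_def abs_mult powr_mult ennreal_mult')
qed

text \<open>
  Each new letter multiplies the moment of the weight by that of one factor, and these sum to at most
  \<open>moment \<mu> a\<close>. The exponent \<open>a = 1\<close> yields finiteness of the
  total mass, and \<open>a = p\<close> the rate of convergence.
\<close>
lemma sum_weight_moments_le:
  assumes "finite F" "F \<subseteq> {e. length e = n}"
  shows "(\<Sum>e\<in>F. \<integral>\<^sup>+\<omega>. ennreal (\<bar>weight U e \<omega>\<bar> powr a) \<partial>M) \<le> moment \<mu> a ^ n"
  using assms
proof (induction n arbitrary: F)
  case 0
  then have "F = {} \<or> F = {[]}" by auto
  then show ?case by (auto simp: emeasure_space_1)
next
  case (Suc n)
  define w where "w = (\<lambda>e. \<integral>\<^sup>+\<omega>. ennreal (\<bar>weight U e \<omega>\<bar> powr a) \<partial>M)"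
  define v where "v = (\<lambda>i. \<integral>\<^sup>+x. ennreal (\<bar>x i\<bar> powr a) \<partial>\<mu>)"
  \<comment> \<open>Enlarge \<open>F\<close> to a product of a set of last letters and a set of words of length \<open>n\<close>.\<close>
  have inj: "inj_on (\<lambda>(i, e). i # e) (hd ` F \<times> tl ` F)" by (auto simp: inj_on_def)
  have "F \<subseteq> (\<lambda>(i, e). i # e) ` (hd ` F \<times> tl ` F)"
  proof
    fix e assume "e \<in> F"
    then have "e = hd e # tl e" using Suc.prems by (cases e) auto
    then show "e \<in> (\<lambda>(i, e). i # e) ` (hd ` F \<times> tl ` F)" using \<open>e \<in> F\<close> by force
  qed
  then have "(\<Sum>e\<in>F. w e) \<le> (\<Sum>e\<in>(\<lambda>(i, e). i # e) ` (hd ` F \<times> tl ` F). w e)"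
    using Suc.prems by (intro sum_mono2) auto
  also have "\<dots> = (\<Sum>(i, e)\<in>hd ` F \<times> tl ` F. w e * v i)"
    unfolding sum.reindex[OF inj]
    by (auto intro!: sum.cong simp: w_def v_def nn_integral_weight_Cons simp del: weight.simps)
  also have "\<dots> = (\<Sum>i\<in>hd ` F. v i) * (\<Sum>e\<in>tl ` F. w e)"
    by (simp add: sum_product sum.cartesian_product mult.commute)
  also have "(\<Sum>i\<in>hd ` F. v i) \<le> (\<Sum>i. v i)"
    using Suc.prems by (intro sum_le_suminf) auto
  also have "(\<Sum>i. v i) = moment \<mu> a"
    unfolding moment_def v_def by (rule nn_integral_suminf[symmetric]) measurable
  also have "(\<Sum>e\<in>tl ` F. w e) \<le> moment \<mu> a ^ n"
    unfolding w_def using Suc.prems by (intro Suc.IH) auto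
  finally show ?case by (simp add: w_def mult_mono)
qed

end

section \<open>The total mass as a sum of increments\<close>

text \<open>
  The sample points at which the pathwise identities hold. Nonnegativity of the copies is part of the
  condition because equality of laws provides it only almost surely.
\<close>
definition regular_point :: "(nat list \<Rightarrow> nat \<Rightarrow> 'a \<Rightarrow> real) \<Rightarrow> 'a \<Rightarrow> bool" where
  "regular_point U \<omega> \<longleftrightarrow> (\<forall>e i. 0 \<le> U e i \<omega>) \<and> (\<forall>e. summable (\<lambda>i. U e i \<omega>)) \<and>
    (\<forall>n. (\<lambda>e. weight U e \<omega>) summable_on {e. length e = n})"

text \<open>
  Grouping the words of length \<open>n + 1\<close> by their parents replaces the sum of their weights by
  \<open>\<Sum> w\<^sub>e S\<^sub>e\<close> over the words of length \<open>n\<close>.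
\<close>
lemma has_sum_increments_level:
  assumes "regular_point U \<omega>"
  shows "((\<lambda>e. weight U e \<omega> * excess (\<lambda>i. U e i \<omega>)) has_sum total_mass U (Suc n) \<omega> - total_mass U n \<omega>) {e. length e = n}"
proof -
  have nonneg: "0 \<le> U e i \<omega>" and summable: "summable (\<lambda>i. U e i \<omega>)"
    and level: "((\<lambda>e. weight U e \<omega>) has_sum total_mass U k \<omega>) {e. length e = k}" for e i k
    using assms by (auto simp: regular_point_def total_mass_def)
  have "((\<lambda>(e, i). weight U (i # e) \<omega>) has_sum total_mass U (Suc n) \<omega>) ({e. length e = n} \<times> UNIV)"
  proof (subst has_sum_reindex_bij_witness[where i = "\<lambda>e. (tl e, hd e)" and j = "\<lambda>(e, i). i # e"])
    show "((\<lambda>e. weight U e \<omega>) has_sum total_mass U (Suc n) \<omega>) {e. length e = Suc n}" by (rule level)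
    fix e :: "nat list" assume "e \<in> {e. length e = Suc n}"
    then show "(case (tl e, hd e) of (e, i) \<Rightarrow> i # e) = e" "(tl e, hd e) \<in> {e. length e = n} \<times> UNIV"
      by (cases e; simp)+
  qed auto
  moreover have "((\<lambda>i. case (e, i) of (e, i) \<Rightarrow> weight U (i # e) \<omega>) has_sum (weight U e \<omega> * (\<Sum>i. U e i \<omega>))) UNIV" for e
    using sums_nonneg_imp_has_sum[OF summable_sums[OF summable[of e]] nonneg]
    by (simp add: has_sum_cmult_right)
  ultimately have "((\<lambda>e. weight U e \<omega> * (\<Sum>i. U e i \<omega>)) has_sum total_mass U (Suc n) \<omega>) {e. length e = n}"
    by (rule has_sum_SigmaD)
  from has_sum_add[OF this has_sum_uminusI[OF level[of n]]] show ?thesis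
    by (simp add: excess_def algebra_simps)
qed

lemma has_sum_increments:
  assumes "regular_point U \<omega>" "n \<le> k"
  shows "((\<lambda>e. weight U e \<omega> * excess (\<lambda>i. U e i \<omega>)) has_sum total_mass U k \<omega> - total_mass U n \<omega>)
    {e. n \<le> length e \<and> length e < k}"
  using assms(2)
proof (induction k rule: dec_induct)
  case (step k)
  have "{e. n \<le> length e \<and> length e < Suc k} = {e. n \<le> length e \<and> length e < k} \<union> {e::nat list. length e = k}"
    using step.hyps by auto
  with has_sum_Un_disjoint[OF step.IH has_sum_increments_level[OF assms(1), of k]] show ?case by auto
next
  case base
  have empty: "{e::nat list. n \<le> length e \<and> length e < n} = {}" by auto
  show ?case unfolding empty by simp
qed

context weighted_branching
begin

lemma AE_family_summable: "AE x in \<mu>. (\<forall>i. 0 \<le> x i) \<and> summable x"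
proof -
  have "AE x in \<mu>. (\<Sum>i. ennreal (\<bar>x i\<bar> powr 1)) \<noteq> \<infinity>"
    using mean unfolding moment_def by (intro nn_integral_PInf_AE) auto
  with nonneg show ?thesis
  proof eventually_elim
    case (elim x)
    then show ?case by (auto intro: summable_suminf_not_top)
  qed
qed

lemma integral_excess: "(\<integral>x. excess x \<partial>\<mu>) = 0"
proof -
  interpret law: prob_space \<mu>
    unfolding law[of "[]", symmetric] by (rule prob_space_distr) measurable
  have "(\<integral>\<^sup>+x. ennreal (\<Sum>i. x i) \<partial>\<mu>) = moment \<mu> 1"
    unfolding moment_def
  proof (rule nn_integral_cong_AE, use AE_family_summable in eventually_elim)
    case (elim x)
    then show ?case by (simp add: suminf_ennreal2)
  qed
  then have nn: "(\<integral>\<^sup>+x. ennreal (\<Sum>i. x i) \<partial>\<mu>) = 1" by (simp add: mean)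
  have pos: "AE x in \<mu>. 0 \<le> (\<Sum>i. x i)"
    using AE_family_summable by eventually_elim (auto intro: suminf_nonneg)
  have int: "integrable \<mu> (\<lambda>x. \<Sum>i. x i)"
    using nn pos by (intro integrableI_nonneg) auto
  have "(\<integral>x. (\<Sum>i. x i) \<partial>\<mu>) = 1"
    using nn pos by (subst integral_eq_nn_integral) auto
  with int show ?thesis
    by (simp add: excess_def law.prob_space)
qed

text \<open>
  The partial sums of the weights of one level have mean at most one, so by monotone convergence their
  supremum is almost surely finite.
\<close>
lemma AE_level_summable: "AE \<omega> in M. (\<lambda>e. weight U e \<omega>) summable_on {e. length e = n}"
proof -
  define T where "T j = {e::nat list \<in> {e. length e = n}. to_nat e < j}" for j
  define S where "S j \<omega> = (\<Sum>e\<in>T j. ennreal (\<bar>weight U e \<omega>\<bar> powr 1))" for j \<omega>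
  have fin: "finite (T j)" for j unfolding T_def by (rule finite_truncation)
  have [measurable]: "S j \<in> borel_measurable M" for j unfolding S_def[abs_def] by measurable
  have "incseq S"
    unfolding S_def by (intro monoI le_funI sum_mono2 fin) (auto simp: T_def)
  then have "(\<integral>\<^sup>+\<omega>. (SUP j. S j \<omega>) \<partial>M) = (SUP j. \<integral>\<^sup>+\<omega>. S j \<omega> \<partial>M)"
    by (rule nn_integral_monotone_convergence_SUP) measurable
  also have "\<dots> \<le> 1"
  proof (rule SUP_least)
    fix j
    have "(\<integral>\<^sup>+\<omega>. S j \<omega> \<partial>M) = (\<Sum>e\<in>T j. \<integral>\<^sup>+\<omega>. ennreal (\<bar>weight U e \<omega>\<bar> powr 1) \<partial>M)"
      unfolding S_def by (rule nn_integral_sum) measurable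
    also have "\<dots> \<le> moment \<mu> 1 ^ n" by (rule sum_weight_moments_le[OF fin]) (auto simp: T_def)
    finally show "(\<integral>\<^sup>+\<omega>. S j \<omega> \<partial>M) \<le> 1" by (simp add: mean)
  qed
  finally have le: "(\<integral>\<^sup>+\<omega>. (SUP j. S j \<omega>) \<partial>M) \<le> 1" .
  have "AE \<omega> in M. (SUP j. S j \<omega>) \<noteq> \<infinity>"
    by (rule nn_integral_PInf_AE) (use le in \<open>auto simp: top_unique\<close>)
  then show ?thesis
  proof eventually_elim
    case (elim \<omega>)
    define s where "s = enn2real (SUP j. S j \<omega>)"
    have bound: "sum (\<lambda>e. norm (weight U e \<omega>)) F \<le> s" if F: "F \<subseteq> {e. length e = n}" "finite F" for F
    proof -
      obtain j where "to_nat ` F \<subseteq> {..<j}" using finite_nat_bounded[of "to_nat ` F"] F by auto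
      then have "F \<subseteq> T j" using F by (auto simp: T_def)
      have "ennreal (sum (\<lambda>e. norm (weight U e \<omega>)) F) = (\<Sum>e\<in>F. ennreal (\<bar>weight U e \<omega>\<bar> powr 1))"
        by (simp add: sum_ennreal)
      also have "\<dots> \<le> S j \<omega>" unfolding S_def by (rule sum_mono2[OF fin \<open>F \<subseteq> T j\<close>]) simp
      also have "\<dots> \<le> (SUP j. S j \<omega>)" by (rule SUP_upper) simp
      also have "\<dots> = ennreal s" using elim unfolding s_def by (intro ennreal_enn2real[symmetric]) (simp only: less_top infinity_ennreal_def)
      finally show ?thesis by (simp add: s_def)
    qed
    have "(\<lambda>e. norm (weight U e \<omega>)) summable_on {e. length e = n}"
      by (rule nonneg_bdd_above_summable_on) (auto intro!: bdd_aboveI2[where M = s] bound[unfolded real_norm_def])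
    then show ?case by (rule abs_summable_summable)
  qed
qed

lemma AE_regular_point: "AE \<omega> in M. regular_point U \<omega>"
proof -
  have "AE \<omega> in M. (\<forall>i. 0 \<le> U e i \<omega>) \<and> summable (\<lambda>i. U e i \<omega>)" for e
    by (rule AE_family[OF AE_family_summable])
  then have "AE \<omega> in M. \<forall>e. (\<forall>i. 0 \<le> U e i \<omega>) \<and> summable (\<lambda>i. U e i \<omega>)"
    by (simp add: AE_all_countable)
  moreover have "AE \<omega> in M. \<forall>n. (\<lambda>e. weight U e \<omega>) summable_on {e. length e = n}"
    using AE_level_summable by (simp add: AE_all_countable)
  ultimately show ?thesis by eventually_elim (simp add: regular_point_def)
qed

end

section \<open>Moment bounds in the subcritical case\<close>

locale subcritical_branching = weighted_branching +
  fixes p :: real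
  assumes p: "1 < p" "p \<le> 2"
    and excess_moment: "integrable \<mu> (\<lambda>x. \<bar>excess x\<bar> powr p)"
    and moment_less_1: "moment \<mu> p < 1"
begin

definition rate :: real where
  "rate = enn2real (moment \<mu> p)"

definition excess_norm :: real where
  "excess_norm = (\<integral>x. \<bar>excess x\<bar> powr p \<partial>\<mu>)"

definition tail_const :: real where
  "tail_const = 3 * excess_norm / (1 - rate)"

lemma moment_eq_rate: "moment \<mu> p = ennreal rate"
  unfolding rate_def
  by (rule ennreal_enn2real[symmetric]) (rule order_less_trans[OF moment_less_1], simp)

lemma rate_bounds: "0 \<le> rate" "rate < 1"
proof -
  show "0 \<le> rate" by (simp add: rate_def)
  then show "rate < 1" using moment_less_1 ennreal_less_iff[of rate 1] by (simp add: moment_eq_rate)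
qed

lemma excess_norm_nonneg: "0 \<le> excess_norm"
  unfolding excess_norm_def by (rule Bochner_Integration.integral_nonneg) simp

lemma tail_const_nonneg: "0 \<le> tail_const"
  using rate_bounds excess_norm_nonneg by (simp add: tail_const_def)

lemma integrable_weight_powr: "integrable M (\<lambda>\<omega>. \<bar>weight U e \<omega>\<bar> powr p)"
proof (rule integrableI_nonneg)
  have "(\<integral>\<^sup>+\<omega>. ennreal (\<bar>weight U e \<omega>\<bar> powr p) \<partial>M) \<le> ennreal rate ^ length e"
    using sum_weight_moments_le[of "{e}" "length e" p] by (simp add: moment_eq_rate)
  also have "\<dots> < \<infinity>" using rate_bounds by (simp add: ennreal_power)
  finally show "(\<integral>\<^sup>+\<omega>. ennreal (\<bar>weight U e \<omega>\<bar> powr p) \<partial>M) < \<infinity>" .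
qed auto

text \<open>
  Words are added in order of nondecreasing length. The newly added word \<open>e\<close> is then a proper prefix of
  none of the earlier ones, nor of itself, so the earlier sum and the weight of \<open>e\<close> are functions of the
  families at words other than \<open>e\<close>.
\<close>
lemma increment_moment:
  assumes "finite F"
  shows "integrable M (\<lambda>\<omega>. \<bar>increment F \<omega>\<bar> powr p) \<and>
    expectation (\<lambda>\<omega>. \<bar>increment F \<omega>\<bar> powr p)
      \<le> 3 * excess_norm * (\<Sum>e\<in>F. expectation (\<lambda>\<omega>. \<bar>weight U e \<omega>\<bar> powr p))"
  using assms
proof (induction F rule: finite_ranking_induct[where f = length])
  case empty
  then show ?case using p by (simp add: increment_def)
next
  case (insert e F)
  show ?case
  proof (cases "e \<in> F")
    case True
    then show ?thesis using insert by (simp add: insert_absorb)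
  next
    case False
    define X where "X \<omega> = excess (\<lambda>i. U e i \<omega>)" for \<omega>
    have [measurable]: "X \<in> borel_measurable M" unfolding X_def by measurable
    have split: "increment (insert e F) = (\<lambda>\<omega>. increment F \<omega> + weight U e \<omega> * X \<omega>)"
      using insert.hyps False by (auto simp: increment_def X_def)
    \<comment> \<open>The earlier sum, as a function of the labels of all words except \<open>e\<close>.\<close>
    define D where "D h = (\<Sum>f\<in>F. weight letter f h * excess (h f))" for h
    have D: "D (\<lambda>e'\<in>- {e}. \<lambda>i. U e' i \<omega>) = increment F \<omega>" for \<omega>
      unfolding D_def increment_def using insert.hyps False
      by (intro sum.cong) (auto simp: weight_restrict)
    have W: "weight letter f \<in> borel_measurable (Pi\<^sub>M (- {e}) (\<lambda>_. seq_borel))"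
      if "length f \<le> length e" for f
      using that by (intro measurable_weight_letter) auto
    have "(\<lambda>h. excess (h f)) \<in> borel_measurable (Pi\<^sub>M (- {e}) (\<lambda>_. seq_borel))" if "f \<in> F" for f
      using that False
      by (intro measurable_compose[OF _ measurable_excess] measurable_component_singleton) auto
    then have [measurable]: "D \<in> borel_measurable (Pi\<^sub>M (- {e}) (\<lambda>_. seq_borel))"
      unfolding D_def[abs_def] using W insert.hyps by (intro borel_measurable_sum borel_measurable_times) auto
    have [measurable]: "weight letter e \<in> borel_measurable (Pi\<^sub>M (- {e}) (\<lambda>_. seq_borel))"
      by (rule W) simp
    have indP: "indep_var borel (\<lambda>\<omega>. sgn (increment F \<omega>) * \<bar>increment F \<omega>\<bar> powr (p - 1) * weight U e \<omega>) borel X"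
      using indep_node[where e = e and f = "\<lambda>h. sgn (D h) * \<bar>D h\<bar> powr (p - 1) * weight letter e h" and ?N1.0 = borel
          and g = excess and ?N2.0 = borel]
      unfolding D weight_restrict[OF order_refl] X_def[abs_def] by measurable
    have indW: "indep_var borel (\<lambda>\<omega>. \<bar>weight U e \<omega>\<bar> powr p) borel (\<lambda>\<omega>. \<bar>X \<omega>\<bar> powr p)"
      using indep_node[where e = e and f = "\<lambda>h. \<bar>weight letter e h\<bar> powr p" and ?N1.0 = borel
          and g = "\<lambda>x. \<bar>excess x\<bar> powr p" and ?N2.0 = borel]
      unfolding weight_restrict[OF order_refl] X_def[abs_def] by measurable
    have X: "integrable M (\<lambda>\<omega>. \<bar>X \<omega>\<bar> powr p)" "expectation (\<lambda>\<omega>. \<bar>X \<omega>\<bar> powr p) = excess_norm" "expectation X = 0"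
      using excess_moment integral_excess unfolding X_def[abs_def] excess_norm_def
      unfolding law[of e, symmetric] by (simp_all add: integrable_distr_eq integral_distr)
    have IH: "integrable M (\<lambda>\<omega>. \<bar>increment F \<omega>\<bar> powr p)" using insert.IH by simp
    have "integrable M (\<lambda>\<omega>. \<bar>increment F \<omega> + weight U e \<omega> * X \<omega>\<bar> powr p)"
      and "expectation (\<lambda>\<omega>. \<bar>increment F \<omega> + weight U e \<omega> * X \<omega>\<bar> powr p)
        \<le> expectation (\<lambda>\<omega>. \<bar>increment F \<omega>\<bar> powr p)
          + 3 * (expectation (\<lambda>\<omega>. \<bar>weight U e \<omega>\<bar> powr p) * expectation (\<lambda>\<omega>. \<bar>X \<omega>\<bar> powr p))"
      by (rule martingale_step[OF p _ _ _ indP indW IH integrable_weight_powr X(1,3)]; measurable)+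
    then show ?thesis
      using insert.IH insert.hyps False by (simp add: split X(2) algebra_simps)
  qed
qed

lemma nn_integral_increment_le:
  assumes "finite F" "F \<subseteq> {e. n \<le> length e}"
  shows "(\<integral>\<^sup>+\<omega>. ennreal (\<bar>increment F \<omega>\<bar> powr p) \<partial>M) \<le> ennreal (tail_const * rate ^ n)"
proof -
  define w where "w e = expectation (\<lambda>\<omega>. \<bar>weight U e \<omega>\<bar> powr p)" for e
  have w_nonneg: "0 \<le> w e" for e unfolding w_def by simp
  have w_enn: "ennreal (w e) = (\<integral>\<^sup>+\<omega>. ennreal (\<bar>weight U e \<omega>\<bar> powr p) \<partial>M)" for e
    unfolding w_def by (rule nn_integral_eq_integral[symmetric]) (auto intro: integrable_weight_powr)
  obtain k where k: "length ` F \<subseteq> {..<k}" using finite_nat_bounded[of "length ` F"] assms by auto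
  have "(\<Sum>e\<in>F. w e) = (\<Sum>j\<in>{n..<k}. \<Sum>e\<in>{e\<in>F. length e = j}. w e)"
  proof (rule sum.group[symmetric])
    show "length ` F \<subseteq> {n..<k}"
    proof
      fix l assume "l \<in> length ` F"
      moreover from this have "l \<in> {..<k}" using k by blast
      ultimately show "l \<in> {n..<k}" using assms(2) by auto
    qed
  qed (use assms in auto)
  also have "\<dots> \<le> (\<Sum>j\<in>{n..<k}. rate ^ j)"
  proof (rule sum_mono)
    fix j
    have "ennreal (\<Sum>e\<in>{e\<in>F. length e = j}. w e) = (\<Sum>e\<in>{e\<in>F. length e = j}. ennreal (w e))"
      by (simp add: sum_ennreal w_nonneg)
    also have "\<dots> \<le> ennreal (rate ^ j)"
      unfolding w_enn using sum_weight_moments_le[of "{e\<in>F. length e = j}" j p] assms rate_bounds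
      by (auto simp: moment_eq_rate ennreal_power)
    finally show "(\<Sum>e\<in>{e\<in>F. length e = j}. w e) \<le> rate ^ j" using rate_bounds by simp
  qed
  also have "\<dots> \<le> rate ^ n / (1 - rate)"
  proof (cases "n \<le> k")
    case True
    have "(1 - rate) * (\<Sum>j\<in>{n..<k}. rate ^ j) = rate ^ n - rate ^ k"
      using True
      by (induction k rule: dec_induct) (simp_all add: distrib_left, simp add: algebra_simps)
    also have "\<dots> \<le> rate ^ n" using rate_bounds by simp
    finally show ?thesis using rate_bounds by (simp add: field_simps)
  qed (use rate_bounds in auto)
  finally have w: "(\<Sum>e\<in>F. w e) \<le> rate ^ n / (1 - rate)" .
  have "(\<integral>\<^sup>+\<omega>. ennreal (\<bar>increment F \<omega>\<bar> powr p) \<partial>M) = ennreal (expectation (\<lambda>\<omega>. \<bar>increment F \<omega>\<bar> powr p))"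
    using increment_moment[OF assms(1)] by (intro nn_integral_eq_integral) auto
  also have "\<dots> \<le> ennreal (3 * excess_norm * (\<Sum>e\<in>F. w e))"
    unfolding w_def using increment_moment[OF assms(1)] by (intro ennreal_leI) simp
  also have "\<dots> \<le> ennreal (tail_const * rate ^ n)"
    using mult_left_mono[OF w, of "3 * excess_norm"] excess_norm_nonneg
    by (intro ennreal_leI) (simp add: tail_const_def)
  finally show ?thesis .
qed

lemma total_mass_diff_moment_le:
  assumes "n \<le> k"
  shows "(\<integral>\<^sup>+\<omega>. ennreal (\<bar>total_mass U k \<omega> - total_mass U n \<omega>\<bar> powr p) \<partial>M) \<le> ennreal (tail_const * rate ^ n)"
proof (rule nn_integral_powr_limit_le)
  let ?A = "{e. n \<le> length e \<and> length e < k}"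
  show "AE \<omega> in M. (\<lambda>j. increment {e\<in>?A. to_nat e < j} \<omega>) \<longlonglongrightarrow> total_mass U k \<omega> - total_mass U n \<omega>"
    using AE_regular_point
  proof eventually_elim
    case (elim \<omega>)
    then show ?case
      unfolding increment_def by (rule has_sum_imp_truncated_sums[OF has_sum_increments]) (rule assms)
  qed
  show "(\<integral>\<^sup>+\<omega>. ennreal (\<bar>increment {e\<in>?A. to_nat e < j} \<omega>\<bar> powr p) \<partial>M) \<le> ennreal (tail_const * rate ^ n)" for j
    by (rule nn_integral_increment_le[OF finite_truncation]) auto
qed (use p in auto)

text \<open>
  A measurable version of \<open>total_mass U n\<close>, equal to it at all regular points.
\<close>
definition mass :: "nat \<Rightarrow> 'a \<Rightarrow> real" where
  "mass n \<omega> = lim (\<lambda>j. \<Sum>e\<in>{e\<in>{e. length e = n}. to_nat e < j}. weight U e \<omega>)"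

lemma measurable_mass [measurable]: "mass n \<in> borel_measurable M"
  unfolding mass_def[abs_def] by measurable

lemma mass_eq_total_mass:
  assumes "regular_point U \<omega>"
  shows "mass n \<omega> = total_mass U n \<omega>"
proof -
  have "((\<lambda>e. weight U e \<omega>) has_sum total_mass U n \<omega>) {e. length e = n}"
    using assms by (simp add: regular_point_def total_mass_def)
  from has_sum_imp_truncated_sums[OF this] show ?thesis
    unfolding mass_def by (rule limI)
qed

lemma AE_total_mass_eq_mass: "AE \<omega> in M. \<forall>n. total_mass U n \<omega> = mass n \<omega>"
  using AE_regular_point by eventually_elim (simp add: mass_eq_total_mass)

lemma mass_diff_moment_le:
  assumes "n \<le> k"
  shows "(\<integral>\<^sup>+\<omega>. ennreal (\<bar>mass k \<omega> - mass n \<omega>\<bar> powr p) \<partial>M) \<le> ennreal (tail_const * rate ^ n)"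
proof -
  have "(\<integral>\<^sup>+\<omega>. ennreal (\<bar>mass k \<omega> - mass n \<omega>\<bar> powr p) \<partial>M)
      = (\<integral>\<^sup>+\<omega>. ennreal (\<bar>total_mass U k \<omega> - total_mass U n \<omega>\<bar> powr p) \<partial>M)"
    by (rule nn_integral_cong_AE, use AE_total_mass_eq_mass in eventually_elim) simp
  with total_mass_diff_moment_le[OF assms] show ?thesis by simp
qed

text \<open>
  Bounding \<open>|d|\<close> by \<open>\<eta> + \<eta>\<^sup>1\<^sup>-\<^sup>p |d|\<^sup>p\<close> with \<open>\<eta> = \<rho>\<^sup>k\<close> turns the moment bound of order \<open>m\<^sup>k\<close>, where
  \<open>m \<le> \<rho>\<^sup>p\<close>, into a first-moment bound of order \<open>\<rho>\<^sup>k\<close>.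
\<close>
lemma AE_summable_mass_steps: "AE \<omega> in M. summable (\<lambda>k. mass (Suc k) \<omega> - mass k \<omega>)"
proof -
  define \<rho> where "\<rho> = max (rate powr (1 / p)) (1 / 2)"
  \<comment> \<open>The maximum with \<open>1/2\<close> keeps \<open>\<rho>\<close> positive, so that negative powers of \<open>\<rho>\<close> make sense even if the rate is zero.\<close>
  have "rate powr (1 / p) < 1"
    using powr_less_mono2[of "1 / p" rate 1] rate_bounds p by simp
  then have \<rho>: "0 < \<rho>" "\<rho> < 1" by (simp_all add: \<rho>_def)
  have rate_le: "rate \<le> \<rho> powr p"
  proof -
    have "rate = (rate powr (1 / p)) powr p" using rate_bounds p by (simp add: powr_powr)
    also have "\<dots> \<le> \<rho> powr p" using p by (intro powr_mono2) (auto simp: \<rho>_def)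
    finally show ?thesis .
  qed
  have step: "(\<integral>\<^sup>+\<omega>. ennreal \<bar>mass (Suc k) \<omega> - mass k \<omega>\<bar> \<partial>M) \<le> ennreal ((1 + tail_const) * \<rho> ^ k)" for k
  proof -
    define \<eta> where "\<eta> = \<rho> ^ k"
    have \<eta>: "\<eta> > 0" using \<rho> by (simp add: \<eta>_def)
    have le: "\<bar>d\<bar> \<le> \<eta> + \<eta> powr (1 - p) * \<bar>d\<bar> powr p" for d :: real
    proof (cases "\<bar>d\<bar> \<le> \<eta>")
      case False
      have "\<bar>d\<bar> = \<bar>d\<bar> powr (1 - p) * \<bar>d\<bar> powr p" using False \<eta> by (simp flip: powr_add)
      also have "\<dots> \<le> \<eta> powr (1 - p) * \<bar>d\<bar> powr p"
        using False \<eta> p by (intro mult_right_mono powr_mono2') auto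
      finally show ?thesis using \<eta> by simp
    qed (auto intro: add_increasing2)
    have "(\<integral>\<^sup>+\<omega>. ennreal \<bar>mass (Suc k) \<omega> - mass k \<omega>\<bar> \<partial>M)
        \<le> (\<integral>\<^sup>+\<omega>. ennreal \<eta> + ennreal (\<eta> powr (1 - p)) * ennreal (\<bar>mass (Suc k) \<omega> - mass k \<omega>\<bar> powr p) \<partial>M)"
      using le \<eta> by (intro nn_integral_mono) (simp flip: ennreal_mult ennreal_plus)
    also have "\<dots> = ennreal \<eta> + ennreal (\<eta> powr (1 - p)) * (\<integral>\<^sup>+\<omega>. ennreal (\<bar>mass (Suc k) \<omega> - mass k \<omega>\<bar> powr p) \<partial>M)"
      by (simp add: nn_integral_add nn_integral_cmult emeasure_space_1)
    also have "\<dots> \<le> ennreal \<eta> + ennreal (\<eta> powr (1 - p)) * ennreal (tail_const * rate ^ k)"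
      by (intro add_left_mono mult_left_mono mass_diff_moment_le) auto
    also have "\<dots> = ennreal (\<eta> + \<eta> powr (1 - p) * (tail_const * rate ^ k))"
      using \<eta> rate_bounds tail_const_nonneg by (simp flip: ennreal_mult ennreal_plus)
    also have "\<eta> powr (1 - p) * (tail_const * rate ^ k) \<le> \<eta> powr (1 - p) * (tail_const * \<eta> powr p)"
    proof -
      have "rate ^ k \<le> (\<rho> powr p) ^ k" using rate_le rate_bounds by (intro power_mono)
      also have "\<dots> = \<eta> powr p"
        using \<rho> by (simp add: \<eta>_def powr_powr mult.commute flip: powr_realpow)
      finally show ?thesis using tail_const_nonneg by (intro mult_left_mono) auto
    qed
    also have "\<eta> powr (1 - p) * (tail_const * \<eta> powr p) = tail_const * (\<eta> powr (1 - p) * \<eta> powr p)" by simp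
    also have "\<eta> powr (1 - p) * \<eta> powr p = \<eta>" using \<eta> by (simp flip: powr_add)
    finally show ?thesis by (simp add: \<eta>_def algebra_simps ennreal_leI)
  qed
  have "(\<integral>\<^sup>+\<omega>. (\<Sum>k. ennreal \<bar>mass (Suc k) \<omega> - mass k \<omega>\<bar>) \<partial>M)
      = (\<Sum>k. \<integral>\<^sup>+\<omega>. ennreal \<bar>mass (Suc k) \<omega> - mass k \<omega>\<bar> \<partial>M)"
    by (rule nn_integral_suminf) measurable
  also have "\<dots> \<le> (\<Sum>k. ennreal ((1 + tail_const) * \<rho> ^ k))"
    by (intro suminf_le step) auto
  also have "\<dots> < \<infinity>"
    using \<rho> tail_const_nonneg
    by (subst suminf_ennreal2) (auto intro!: summable_mult summable_geometric)
  finally have "AE \<omega> in M. (\<Sum>k. ennreal \<bar>mass (Suc k) \<omega> - mass k \<omega>\<bar>) \<noteq> \<infinity>"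
    by (intro nn_integral_PInf_AE) auto
  then show ?thesis
  proof eventually_elim
    case (elim \<omega>)
    then have "summable (\<lambda>k. \<bar>mass (Suc k) \<omega> - mass k \<omega>\<bar>)"
      by (intro summable_suminf_not_top) auto
    then show ?case by (rule summable_rabs_cancel)
  qed
qed

lemma AE_mass_tendsto_limit_mass: "AE \<omega> in M. (\<lambda>n. mass n \<omega>) \<longlonglongrightarrow> limit_mass U \<omega>"
  using AE_summable_mass_steps AE_total_mass_eq_mass
proof eventually_elim
  case (elim \<omega>)
  have "(\<lambda>n. \<Sum>k<n. mass (Suc k) \<omega> - mass k \<omega>) \<longlonglongrightarrow> (\<Sum>k. mass (Suc k) \<omega> - mass k \<omega>)"
    using elim(1) by (rule summable_LIMSEQ)
  then have "(\<lambda>n. (\<Sum>k<n. mass (Suc k) \<omega> - mass k \<omega>) + mass 0 \<omega>) \<longlonglongrightarrow> (\<Sum>k. mass (Suc k) \<omega> - mass k \<omega>) + mass 0 \<omega>"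
    by (intro tendsto_intros)
  then have "convergent (\<lambda>n. mass n \<omega>)"
    unfolding sum_lessThan_telescope[of "\<lambda>k. mass k \<omega>"] diff_add_cancel by (rule convergentI)
  then show ?case
    using elim(2) by (simp add: convergent_LIMSEQ_iff limit_mass_def)
qed

lemma limit_mass_moment_le:
  "(\<integral>\<^sup>+\<omega>. ennreal (\<bar>total_mass U n \<omega> - limit_mass U \<omega>\<bar> powr p) \<partial>M) \<le> ennreal (tail_const * rate ^ n)"
proof -
  have "(\<integral>\<^sup>+\<omega>. ennreal (\<bar>limit_mass U \<omega> - mass n \<omega>\<bar> powr p) \<partial>M) \<le> ennreal (tail_const * rate ^ n)"
  proof (rule nn_integral_powr_limit_le)
    show "AE \<omega> in M. (\<lambda>j. mass (n + j) \<omega> - mass n \<omega>) \<longlonglongrightarrow> limit_mass U \<omega> - mass n \<omega>"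
      using AE_mass_tendsto_limit_mass
    proof eventually_elim
      case (elim \<omega>)
      from LIMSEQ_ignore_initial_segment[OF this, of n] show ?case
        by (intro tendsto_diff tendsto_const) (simp add: add.commute)
    qed
    show "(\<integral>\<^sup>+\<omega>. ennreal (\<bar>mass (n + j) \<omega> - mass n \<omega>\<bar> powr p) \<partial>M) \<le> ennreal (tail_const * rate ^ n)" for j
      by (rule mass_diff_moment_le) simp
  qed (use p in auto)
  moreover have "(\<integral>\<^sup>+\<omega>. ennreal (\<bar>limit_mass U \<omega> - mass n \<omega>\<bar> powr p) \<partial>M)
      = (\<integral>\<^sup>+\<omega>. ennreal (\<bar>total_mass U n \<omega> - limit_mass U \<omega>\<bar> powr p) \<partial>M)"
    by (rule nn_integral_cong_AE, use AE_total_mass_eq_mass in eventually_elim) (simp add: abs_minus_commute)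
  ultimately show ?thesis by simp
qed

end

section \<open>Passage from the random family to its law\<close>

lemma ennpow_ennreal: "0 \<le> x \<Longrightarrow> 0 < a \<Longrightarrow> ennpow (ennreal x) a = ennreal (x powr a)"
  by (simp add: ennpow_def)

lemma measurable_random_family:
  assumes "nonneg_random_family N u"
  shows "(\<lambda>\<omega> i. u i \<omega>) \<in> N \<rightarrow>\<^sub>M seq_borel"
  by (rule measurable_PiM_single') (use assms in \<open>auto simp: nonneg_random_family_def\<close>)

lemma moment_distr:
  assumes "nonneg_random_family N u"
  shows "moment (distr N seq_borel (\<lambda>\<omega> i. u i \<omega>)) a = (\<integral>\<^sup>+\<omega>. (\<Sum>i. ennreal (u i \<omega> powr a)) \<partial>N)"
proof -
  note [measurable] = measurable_random_family[OF assms]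
  have "moment (distr N seq_borel (\<lambda>\<omega> i. u i \<omega>)) a = (\<integral>\<^sup>+\<omega>. (\<Sum>i. ennreal (\<bar>u i \<omega>\<bar> powr a)) \<partial>N)"
    unfolding moment_def by (rule nn_integral_distr) measurable
  also have "\<dots> = (\<integral>\<^sup>+\<omega>. (\<Sum>i. ennreal (u i \<omega> powr a)) \<partial>N)"
    using assms by (intro nn_integral_cong) (simp add: nonneg_random_family_def)
  finally show ?thesis .
qed

lemma excess_powr_le_ennpow:
  assumes x: "\<And>i. 0 \<le> x i" and p: "0 < p"
  shows "ennreal (\<bar>excess x\<bar> powr p) \<le> 1 + ennpow (\<Sum>i. ennreal (x i)) p"
proof (cases "(\<Sum>i. ennreal (x i)) = \<infinity>")
  case False
  then have summable: "summable x" using x by (intro summable_suminf_not_top) auto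
  define s where "s = (\<Sum>i. x i)"
  have s: "s \<ge> 0" unfolding s_def using summable x by (rule suminf_nonneg)
  have "\<bar>s - 1\<bar> powr p \<le> max 1 s powr p" using s p by (intro powr_mono2) auto
  also have "\<dots> \<le> 1 + s powr p" by (simp add: max_def)
  finally have "ennreal (\<bar>s - 1\<bar> powr p) \<le> ennreal (1 + s powr p)" by (rule ennreal_leI)
  also have "\<dots> = 1 + ennpow (\<Sum>i. ennreal (x i)) p"
    using s p by (simp add: suminf_ennreal2[OF x summable] ennpow_ennreal flip: s_def)
  finally show ?thesis by (simp add: excess_def s_def)
qed (use p in \<open>simp add: ennpow_def\<close>)

lemma integrable_excess_powr:
  assumes fam: "nonneg_random_family N u" and p: "0 < p"
    and fin: "(\<integral>\<^sup>+\<omega>. ennpow (\<Sum>i. ennreal (u i \<omega>)) p \<partial>N) < \<infinity>"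
  shows "integrable (distr N seq_borel (\<lambda>\<omega> i. u i \<omega>)) (\<lambda>x. \<bar>excess x\<bar> powr p)"
proof -
  interpret N: prob_space N using fam by (simp add: nonneg_random_family_def)
  note [measurable] = measurable_random_family[OF fam]
  have [measurable]: "u i \<in> borel_measurable N" for i using fam by (simp add: nonneg_random_family_def)
  have [measurable]: "(\<lambda>x. ennpow x p) \<in> borel_measurable borel"
    unfolding ennpow_def[abs_def] by measurable
  have "(\<integral>\<^sup>+\<omega>. ennreal (\<bar>excess (\<lambda>i. u i \<omega>)\<bar> powr p) \<partial>N) \<le> (\<integral>\<^sup>+\<omega>. 1 + ennpow (\<Sum>i. ennreal (u i \<omega>)) p \<partial>N)"
    using fam p by (intro nn_integral_mono excess_powr_le_ennpow) (auto simp: nonneg_random_family_def)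
  also have "\<dots> = 1 + (\<integral>\<^sup>+\<omega>. ennpow (\<Sum>i. ennreal (u i \<omega>)) p \<partial>N)"
    by (subst nn_integral_add) (auto simp: N.emeasure_space_1)
  also have "\<dots> < \<infinity>" using fin by simp
  finally have "integrable N (\<lambda>\<omega>. \<bar>excess (\<lambda>i. u i \<omega>)\<bar> powr p)"
    by (intro integrableI_nonneg) auto
  then show ?thesis by (subst integrable_distr_eq) simp_all
qed

lemma ennpow_le_ennreal:
  assumes "x \<le> ennreal y" "0 \<le> y" "0 < a"
  shows "ennpow x a \<le> ennreal (y powr a)"
proof -
  obtain z where z: "x = ennreal z" "0 \<le> z" "z \<le> y"
    using assms by (cases x) (auto simp: top_unique)
  then show ?thesis using assms by (simp add: ennpow_ennreal ennreal_leI powr_mono2)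
qed

theorem proposition1:
  fixes p :: real
    and N :: "'b measure" and u :: "nat \<Rightarrow> 'b \<Rightarrow> real"
    and M :: "'a measure" and U :: "nat list \<Rightarrow> nat \<Rightarrow> 'a \<Rightarrow> real"
  assumes "p \<in> {1<..2}"
    and "nonneg_random_family N u"
    and "(\<integral>\<^sup>+\<omega>. (\<Sum>i. ennreal (u i \<omega>)) \<partial>N) = 1"
    and "independent_copies N u M U"
    and "(\<integral>\<^sup>+\<omega>. ennpow (\<Sum>i. ennreal (u i \<omega>)) p \<partial>N) < \<infinity>"
    and "(\<integral>\<^sup>+\<omega>. (\<Sum>i. ennreal (u i \<omega> powr p)) \<partial>N) < 1"
  shows "\<exists>C>0. \<forall>n::nat.
    ennpow (\<integral>\<^sup>+\<omega>. ennreal (\<bar>total_mass U n \<omega> - limit_mass U \<omega>\<bar> powr p) \<partial>M) (1 / p)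
      \<le> ennreal C * ennpow (\<integral>\<^sup>+\<omega>. (\<Sum>i. ennreal (u i \<omega> powr p)) \<partial>N) (real n / p)"
proof -
  define \<mu> where "\<mu> = distr N seq_borel (\<lambda>\<omega> i. u i \<omega>)"
  have p: "1 < p" "p \<le> 2" using assms(1) by auto
  note [measurable] = measurable_random_family[OF assms(2)]
  have u: "\<omega> \<in> space N \<Longrightarrow> 0 \<le> u i \<omega>" for i \<omega>
    using assms(2) by (auto simp: nonneg_random_family_def)
  have moment: "moment \<mu> a = (\<integral>\<^sup>+\<omega>. (\<Sum>i. ennreal (u i \<omega> powr a)) \<partial>N)" for a
    unfolding \<mu>_def by (rule moment_distr) (rule assms(2))
  have copies: "prob_space M" "prob_space.indep_vars M (\<lambda>_. seq_borel) (\<lambda>e \<omega> i. U e i \<omega>) UNIV"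
    "distr M seq_borel (\<lambda>\<omega> i. U e i \<omega>) = \<mu>" for e
    using assms(4) by (simp_all add: independent_copies_def \<mu>_def)
  interpret prob_space M by (rule copies)
  interpret subcritical_branching M U \<mu> p
  proof
    show "indep_vars (\<lambda>_. seq_borel) (\<lambda>e \<omega> i. U e i \<omega>) UNIV" by (rule copies)
    show "distr M seq_borel (\<lambda>\<omega> i. U e i \<omega>) = \<mu>" for e by (rule copies)
    show "AE x in \<mu>. \<forall>i. 0 \<le> x i"
      unfolding \<mu>_def by (subst AE_distr_iff) (auto simp: u)
    have "(\<integral>\<^sup>+\<omega>. (\<Sum>i. ennreal (u i \<omega> powr 1)) \<partial>N) = (\<integral>\<^sup>+\<omega>. (\<Sum>i. ennreal (u i \<omega>)) \<partial>N)"
      by (intro nn_integral_cong) (simp add: u)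
    then show "moment \<mu> 1 = 1" by (simp add: moment assms(3))
    show "integrable \<mu> (\<lambda>x. \<bar>excess x\<bar> powr p)"
      unfolding \<mu>_def using assms(2,5) p by (intro integrable_excess_powr) auto
    show "moment \<mu> p < 1" using assms(6) by (simp add: moment)
  qed (rule p)+
  show ?thesis
  proof (intro exI conjI allI)
    \<comment> \<open>The summand 1 makes the constant positive when \<open>S = 1\<close> almost surely.\<close>
    let ?C = "(tail_const + 1) powr (1 / p)"
    show "0 < ?C" using tail_const_nonneg by simp
    fix n :: nat
    have "ennpow (\<integral>\<^sup>+\<omega>. ennreal (\<bar>total_mass U n \<omega> - limit_mass U \<omega>\<bar> powr p) \<partial>M) (1 / p)
        \<le> ennreal ((tail_const * rate ^ n) powr (1 / p))"
      using tail_const_nonneg rate_bounds p by (intro ennpow_le_ennreal limit_mass_moment_le) auto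
    also have "\<dots> \<le> ennreal (((tail_const + 1) * rate ^ n) powr (1 / p))"
      using tail_const_nonneg rate_bounds p by (intro ennreal_leI powr_mono2 mult_right_mono) auto
    also have "\<dots> = ennreal ?C * ennreal ((rate ^ n) powr (1 / p))"
      using tail_const_nonneg rate_bounds by (simp add: powr_mult flip: ennreal_mult)
    also have "ennreal ((rate ^ n) powr (1 / p)) = ennpow (ennreal rate) (real n / p)"
    proof (cases "n = 0")
      case False
      then have "(rate ^ n) powr (1 / p) = rate powr (real n / p)"
        using rate_bounds p
        by (cases "rate = 0") (simp_all add: powr_powr flip: powr_realpow)
      then show ?thesis using False rate_bounds p by (simp add: ennpow_ennreal)
    qed (simp add: ennpow_def)
    also have "ennreal rate = (\<integral>\<^sup>+\<omega>. (\<Sum>i. ennreal (u i \<omega> powr p)) \<partial>N)"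
      by (simp add: moment flip: moment_eq_rate)
    finally show "ennpow (\<integral>\<^sup>+\<omega>. ennreal (\<bar>total_mass U n \<omega> - limit_mass U \<omega>\<bar> powr p) \<partial>M) (1 / p)
      \<le> ennreal ?C * ennpow (\<integral>\<^sup>+\<omega>. (\<Sum>i. ennreal (u i \<omega> powr p)) \<partial>N) (real n / p)" .
  qed
qed

end
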